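(* Let $\epsilon>0$. If an inventory-agnostic policy $\mu$ that offers a deterministic sequence of assortments satisfies $$\mathrm{rev}(M_{jt}(\mu,S))\;\le\;\Big(1+\epsilon\,\frac{4}{mT}\Big)\,\mathrm{rev}(\mu)\qquad\text{for all } j\in\mathcal J,\ t\in\mathcal T,\ S\subseteq\mathcal N,$$ then $\mathrm{rev}(\mu)\ge\big(\tfrac12-\epsilon\big)\,\mathrm{opt}^{\mathrm{det}}$.
   Context: Model. Products $\mathcal N=\{1,\dots,n\}$; product $i$ has revenue $r_i\ge 0$ and initial inventory $c_i\in\mathbb Z_+$. Customer types $\mathcal J=\{1,\dots,m\}$; time periods $\mathcal T=\{1,\dots,T\}$. At each period $t$ exactly one customer arrives, of type $j$ with probability $\lambda_{jt}\ge0$, $\sum_{j\in\mathcal J}\lambda_{jt}=1$; arrivals and choices at different periods are independent. If assortment $S\subseteq\mathcal N$ is offered to a type-$j$ customer, she chooses product $i$ with probability $\phi_{ij}(S)\ge0$ and chooses nothing with probability $1-\sum_{i\in\mathcal N}\phi_{ij}(S)\ge 0$; $\phi_{ij}(S)=0$ for $i\notin S$. Substitutability: $\phi_{ij}(S\cup\{\ell\})\le\phi_{ij}(S)$ for all $i\in S$, $\ell\notin S$, $j\in\mathcal J$, $S\subseteq\mathcal N$. Policies. A sampling-based inventory-agnostic policy $\mu$ is given by mutually independent random assortments $(S^\mu_{jt}: j\in\mathcal J, t\in\mathcal T)$, independent of arrivals and choices; if a type-$j$ customer arrives at period $t$, the assortment $S^\mu_{jt}$ is offered regardless of remaining inventories.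 If the customer chooses a product with no remaining inventory she leaves without a purchase; otherwise, if she chooses product $i$, one unit of its inventory is consumed and revenue $r_i$ is collected. $\mathrm{rev}(\mu)$ is the total expected revenue of $\mu$ over the selling horizon. Explicitly, with $\varphi^\mu_{it}=\sum_{j}\lambda_{jt}\sum_{S}\mathbb P\{S^\mu_{jt}=S\}\phi_{ij}(S)$ and, for each $i$, independent Bernoulli random variables $B^\mu_{it}$ ($t\in\mathcal T$) with parameters $\varphi^\mu_{it}$, $\mathrm{rev}(\mu)=\sum_{i}r_i\,\mathbb E\{\min\{c_i,\sum_{t\in\mathcal T}B^\mu_{it}\}\}$. A policy offers a deterministic sequence of assortments if every $S^\mu_{jt}$ is deterministic. $M_{jt}(\mu,S)$ denotes the policy obtained from $\mu$ by replacing $S^\mu_{jt}$ with the deterministic assortment $S$, keeping all else unchanged. $\mathrm{opt}^{\mathrm{det}}$ is the maximum of $\mathrm{rev}(\mu)$ over all inventory-agnostic policies that offer a deterministic sequence of assortments (equivalently, over all sampling-based inventory-agnostic policies). *)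

theory Defs
  imports "HOL-Probability.Probability"
begin

(* Products, customer types and time periods are 1..n, 1..m and 1..T. *)
record retail_model =
  num_products :: nat
  num_types :: nat
  horizon :: nat
  revenue :: "nat \<Rightarrow> real"
  stock :: "nat \<Rightarrow> nat"
  arrival_prob :: "nat \<Rightarrow> nat \<Rightarrow> real"  (* type, then period *)
  choice_prob :: "nat \<Rightarrow> nat \<Rightarrow> nat set \<Rightarrow> real"  (* product, then type, then assortment *)

definition products :: "retail_model \<Rightarrow> nat set" where
  "products M = {1..num_products M}"

definition types :: "retail_model \<Rightarrow> nat set" where
  "types M = {1..num_types M}"

definition periods :: "retail_model \<Rightarrow> nat set" where
  "periods M = {1..horizon M}"

definition substitutable :: "retail_model \<Rightarrow> bool" where
  "substitutable M \<longleftrightarrow>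
     (\<forall>S j. S \<subseteq> products M \<longrightarrow> j \<in> types M \<longrightarrow>
       (\<forall>i\<in>S. \<forall>l\<in>products M - S. choice_prob M i j (S \<union> {l}) \<le> choice_prob M i j S))"

definition valid_model :: "retail_model \<Rightarrow> bool" where
  "valid_model M \<longleftrightarrow>
     (\<forall>i\<in>products M. revenue M i \<ge> 0) \<and>
     (\<forall>j\<in>types M. \<forall>t\<in>periods M. arrival_prob M j t \<ge> 0) \<and>
     (\<forall>t\<in>periods M. (\<Sum>j\<in>types M. arrival_prob M j t) = 1) \<and>
     (\<forall>j\<in>types M. \<forall>S. S \<subseteq> products M \<longrightarrow>
        (\<forall>i\<in>products M. choice_prob M i j S \<ge> 0) \<and>
        (\<forall>i\<in>products M - S. choice_prob M i j S = 0) \<and>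
        1 - (\<Sum>i\<in>products M. choice_prob M i j S) \<ge> 0) \<and>
     substitutable M"

definition arrival_pmf :: "retail_model \<Rightarrow> nat \<Rightarrow> nat pmf" where
  "arrival_pmf M t = embed_pmf (\<lambda>j. if j \<in> types M then arrival_prob M j t else 0)"

definition choice_pmf :: "retail_model \<Rightarrow> nat \<Rightarrow> nat set \<Rightarrow> nat option pmf" where
  "choice_pmf M j S = embed_pmf (\<lambda>x. case x of
       None \<Rightarrow> 1 - (\<Sum>i\<in>products M. choice_prob M i j S)
     | Some i \<Rightarrow> if i \<in> products M then choice_prob M i j S else 0)"

(* A sampling-based inventory-agnostic policy is given by the marginal laws mu j t of its
   random assortments. These are mutually independent, so the marginals determine the joint law. *)
type_synonym policy = "nat \<Rightarrow> nat \<Rightarrow> nat set pmf"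

definition is_policy :: "retail_model \<Rightarrow> policy \<Rightarrow> bool" where
  "is_policy M \<mu> \<longleftrightarrow> (\<forall>j\<in>types M. \<forall>t\<in>periods M. set_pmf (\<mu> j t) \<subseteq> Pow (products M))"

definition deterministic_policy :: "retail_model \<Rightarrow> policy \<Rightarrow> bool" where
  "deterministic_policy M \<mu> \<longleftrightarrow>
     is_policy M \<mu> \<and> (\<forall>j\<in>types M. \<forall>t\<in>periods M. \<exists>S. \<mu> j t = return_pmf S)"

definition replace_assortment :: "policy \<Rightarrow> nat \<Rightarrow> nat \<Rightarrow> nat set \<Rightarrow> policy" where
  "replace_assortment \<mu> j t S = \<mu>(j := (\<mu> j)(t := return_pmf S))"

(* Product chosen in a single period; whether it is still in stock plays no role here. *)
definition period_choice :: "retail_model \<Rightarrow> policy \<Rightarrow> nat \<Rightarrow> nat option pmf" where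
  "period_choice M \<mu> t =
     bind_pmf (arrival_pmf M t) (\<lambda>j. bind_pmf (\<mu> j t) (\<lambda>S. choice_pmf M j S))"

definition choice_process :: "retail_model \<Rightarrow> policy \<Rightarrow> (nat \<Rightarrow> nat option) pmf" where
  "choice_process M \<mu> = Pi_pmf (periods M) None (period_choice M \<mu>)"

(* Inventory at the end of a period along a path X of choices. The truncated subtraction
   leaves an exhausted product at 0. *)
primrec inventory :: "retail_model \<Rightarrow> (nat \<Rightarrow> nat option) \<Rightarrow> nat \<Rightarrow> nat \<Rightarrow> nat" where
  "inventory M X 0 = stock M"
| "inventory M X (Suc t) =
     (\<lambda>i. if X (Suc t) = Some i then inventory M X t i - 1 else inventory M X t i)"

definition collected :: "retail_model \<Rightarrow> (nat \<Rightarrow> nat option) \<Rightarrow> nat \<Rightarrow> real" where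
  "collected M X t = (case X t of None \<Rightarrow> 0
     | Some i \<Rightarrow> if inventory M X (t - 1) i > 0 then revenue M i else 0)"

definition policy_rev :: "retail_model \<Rightarrow> policy \<Rightarrow> real" where
  "policy_rev M \<mu> = measure_pmf.expectation (choice_process M \<mu>) (\<lambda>X. \<Sum>t\<in>periods M. collected M X t)"

(* The maximum is over a finite nonempty set of values, see finite_policy_rev_deterministic below. *)
definition opt_det :: "retail_model \<Rightarrow> real" where
  "opt_det M = Max (policy_rev M ` {\<mu>. deterministic_policy M \<mu>})"


lemma pmf_arrival:
  assumes "valid_model M" "t \<in> periods M"
  shows "pmf (arrival_pmf M t) j = (if j \<in> types M then arrival_prob M j t else 0)"
  unfolding arrival_pmf_def
proof (rule pmf_embed_pmf)
  show "0 \<le> (if x \<in> types M then arrival_prob M x t else 0)" for x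
    using assms by (auto simp: valid_model_def)
  have fin: "finite (types M)" by (simp add: types_def)
  have "(\<integral>\<^sup>+ x. ennreal (if x \<in> types M then arrival_prob M x t else 0) \<partial>count_space UNIV)
      = (\<Sum>x\<in>types M. ennreal (if x \<in> types M then arrival_prob M x t else 0))"
    by (rule nn_integral_count_space'[OF fin]) auto
  also have "\<dots> = ennreal (\<Sum>x\<in>types M. arrival_prob M x t)"
    using assms by (auto simp: valid_model_def intro!: sum_ennreal)
  finally show "(\<integral>\<^sup>+ x. ennreal (if x \<in> types M then arrival_prob M x t else 0) \<partial>count_space UNIV) = 1"
    using assms by (simp add: valid_model_def)
qed

lemma pmf_choice:
  assumes "valid_model M" "j \<in> types M" "S \<subseteq> products M"
  shows "pmf (choice_pmf M j S) x = (case x of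
       None \<Rightarrow> 1 - (\<Sum>i\<in>products M. choice_prob M i j S)
     | Some i \<Rightarrow> if i \<in> products M then choice_prob M i j S else 0)" (is "_ = ?f x")
  unfolding choice_pmf_def
proof (rule pmf_embed_pmf)
  have nn: "\<forall>i\<in>products M. choice_prob M i j S \<ge> 0"
    "1 - (\<Sum>i\<in>products M. choice_prob M i j S) \<ge> 0"
    using assms unfolding valid_model_def by blast+
  show f0: "0 \<le> ?f x" for x
    using nn by (auto split: option.splits)
  have fin: "finite (products M)" by (simp add: products_def)
  let ?A = "insert None (Some ` products M)"
  have "(\<integral>\<^sup>+ x. ennreal (?f x) \<partial>count_space UNIV) = (\<Sum>x\<in>?A. ennreal (?f x))"
    using fin by (intro nn_integral_count_space') (auto split: option.splits)
  also have "\<dots> = ennreal (\<Sum>x\<in>?A. ?f x)"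
    using f0 by (intro sum_ennreal) auto
  also have "(\<Sum>x\<in>?A. ?f x) = 1"
    using fin by (subst sum.insert) (auto simp: sum.reindex)
  finally show "(\<integral>\<^sup>+ x. ennreal (?f x) \<partial>count_space UNIV) = 1" by simp
qed

lemma set_choice_process:
  assumes "valid_model M" "is_policy M \<mu>" "X \<in> set_pmf (choice_process M \<mu>)"
  shows "X t \<in> insert None (Some ` products M)"
proof (cases "t \<in> periods M")
  case True
  have "X t \<in> set_pmf (period_choice M \<mu> t)"
    using assms(3) True
    by (auto simp: choice_process_def set_Pi_pmf periods_def PiE_dflt_def)
  then obtain j S where *: "j \<in> set_pmf (arrival_pmf M t)" "S \<in> set_pmf (\<mu> j t)"
    "X t \<in> set_pmf (choice_pmf M j S)"
    by (auto simp: period_choice_def)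
  have j: "j \<in> types M"
    using *(1) pmf_arrival[OF assms(1) True, of j] by (auto simp: set_pmf_eq split: if_splits)
  then have "S \<subseteq> products M"
    using *(2) assms(2) True by (auto simp: is_policy_def)
  from *(3) pmf_choice[OF assms(1) j this, of "X t"] show ?thesis
    by (auto simp: set_pmf_eq split: option.splits if_splits)
next
  case False
  then show ?thesis
    using assms(3) by (auto simp: choice_process_def set_Pi_pmf PiE_dflt_def periods_def)
qed

lemma finite_set_choice_process:
  assumes "valid_model M" "is_policy M \<mu>"
  shows "finite (set_pmf (choice_process M \<mu>))"
proof -
  have "set_pmf (choice_process M \<mu>) \<subseteq>
      PiE_dflt (periods M) None (\<lambda>_. insert None (Some ` products M))"
  proof
    fix X assume X: "X \<in> set_pmf (choice_process M \<mu>)"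
    have "X t = None" if "t \<notin> periods M" for t
      using X that by (simp add: choice_process_def set_Pi_pmf PiE_dflt_def periods_def)
    then show "X \<in> PiE_dflt (periods M) None (\<lambda>_. insert None (Some ` products M))"
      using set_choice_process[OF assms X] by (simp add: PiE_dflt_def)
  qed
  moreover have "finite (PiE_dflt (periods M) None (\<lambda>_. insert None (Some ` products M)))"
    by (intro finite_PiE_dflt) (auto simp: periods_def products_def)
  ultimately show ?thesis by (rule finite_subset)
qed

lemma inventory_eq:
  "inventory M X t i = stock M i - card {s\<in>{1..t}. X s = Some i}"
proof (induction t)
  case (Suc t)
  have "{s\<in>{1..Suc t}. X s = Some i} =
      (if X (Suc t) = Some i then insert (Suc t) {s\<in>{1..t}. X s = Some i}
       else {s\<in>{1..t}. X s = Some i})"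
    by (auto simp: le_Suc_eq)
  then show ?case using Suc by auto
qed simp

lemma sum_collected:
  assumes "\<And>t. X t \<in> insert None (Some ` products M)"
  shows "(\<Sum>t=1..k. collected M X t) =
    (\<Sum>i\<in>products M. revenue M i * real (min (stock M i) (card {s\<in>{1..k}. X s = Some i})))"
proof (induction k)
  case (Suc k)
  let ?n = "\<lambda>k i. card {s\<in>{1..k}. X s = Some i}"
  have n: "?n (Suc k) i = (if X (Suc k) = Some i then Suc (?n k i) else ?n k i)" for i
  proof -
    have "{s\<in>{1..Suc k}. X s = Some i} =
      (if X (Suc k) = Some i then insert (Suc k) {s\<in>{1..k}. X s = Some i}
       else {s\<in>{1..k}. X s = Some i})"
      by (auto simp: le_Suc_eq)
    then show ?thesis by auto
  qed
  have "collected M X (Suc k) = (\<Sum>i\<in>products M. if X (Suc k) = Some i then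
          (if inventory M X k i > 0 then revenue M i else 0) else 0)"
    using assms[of "Suc k"] by (auto simp: collected_def products_def sum.delta)
  also have "\<dots> = (\<Sum>i\<in>products M.
      revenue M i * real (min (stock M i) (?n (Suc k) i)) - revenue M i * real (min (stock M i) (?n k i)))"
  proof (intro sum.cong refl)
    fix i
    have "min a (Suc b) = (if a - b > 0 then Suc (min a b) else min a b)" for a b :: nat
      by auto
    then show "(if X (Suc k) = Some i then (if inventory M X k i > 0 then revenue M i else 0) else 0) =
        revenue M i * real (min (stock M i) (?n (Suc k) i)) - revenue M i * real (min (stock M i) (?n k i))"
      unfolding n inventory_eq by (simp add: algebra_simps)
  qed
  finally show ?case using Suc by (simp add: sum_subtractf)
qed simp

definition purchase_prob :: "retail_model \<Rightarrow> policy \<Rightarrow> nat \<Rightarrow> nat \<Rightarrow> real" where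
  "purchase_prob M \<mu> i t = (\<Sum>j\<in>types M. arrival_prob M j t *
     (\<Sum>S\<in>Pow (products M). pmf (\<mu> j t) S * choice_prob M i j S))"

lemma pmf_period_choice:
  assumes "valid_model M" "is_policy M \<mu>" "t \<in> periods M" "i \<in> products M"
  shows "pmf (period_choice M \<mu> t) (Some i) = purchase_prob M \<mu> i t"
proof -
  have inner: "pmf (bind_pmf (\<mu> j t) (choice_pmf M j)) (Some i) =
      (\<Sum>S\<in>Pow (products M). pmf (\<mu> j t) S * choice_prob M i j S)" if j: "j \<in> types M" for j
  proof -
    have "pmf (bind_pmf (\<mu> j t) (choice_pmf M j)) (Some i) =
       (\<Sum>S\<in>Pow (products M). pmf (choice_pmf M j S) (Some i) * pmf (\<mu> j t) S)"
      unfolding pmf_bind using assms j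
      by (intro integral_measure_pmf_real) (auto simp: products_def is_policy_def)
    also have "\<dots> = (\<Sum>S\<in>Pow (products M). pmf (\<mu> j t) S * choice_prob M i j S)"
      using assms j by (intro sum.cong) (auto simp: pmf_choice)
    finally show ?thesis .
  qed
  have "pmf (period_choice M \<mu> t) (Some i) =
      (\<Sum>j\<in>types M. pmf (bind_pmf (\<mu> j t) (choice_pmf M j)) (Some i) * pmf (arrival_pmf M t) j)"
    unfolding period_choice_def pmf_bind[of "arrival_pmf M t"]
    by (intro integral_measure_pmf_real)
       (auto simp: types_def set_pmf_eq pmf_arrival[OF assms(1,3)] split: if_splits)
  then show ?thesis
    by (simp add: inner pmf_arrival[OF assms(1,3)] purchase_prob_def mult.commute)
qed

lemma map_period_choice:
  assumes "valid_model M" "is_policy M \<mu>" "t \<in> periods M" "i \<in> products M"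
  shows "map_pmf (\<lambda>x. x = Some i) (period_choice M \<mu> t) = bernoulli_pmf (purchase_prob M \<mu> i t)"
proof -
  let ?p = "map_pmf (\<lambda>x. x = Some i) (period_choice M \<mu> t)"
  let ?q = "bernoulli_pmf (purchase_prob M \<mu> i t)"
  have "pmf ?p True = purchase_prob M \<mu> i t"
    by (simp add: pmf_map vimage_def measure_pmf_single pmf_period_choice[OF assms])
  moreover from this have "0 \<le> purchase_prob M \<mu> i t" "purchase_prob M \<mu> i t \<le> 1"
    by (metis pmf_nonneg, metis pmf_le_1)
  ultimately have T: "pmf ?p True = pmf ?q True" by simp
  have tot: "pmf r True + pmf r False = 1" for r :: "bool pmf"
    using sum_pmf_eq_1[OF finite subset_UNIV, of r] by (simp add: UNIV_bool add.commute)
  show ?thesis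
  proof (rule pmf_eqI)
    have F: "pmf ?p False = pmf ?q False"
      using T tot[of ?p] tot[of ?q] by linarith
    show "pmf ?p b = pmf ?q b" for b
      using T F by (metis (full_types))
  qed
qed

(* Closed form of policy_rev: only the independent indicators of "product i is chosen in period t"
   matter, one product at a time. *)
lemma policy_rev_eq:
  assumes "valid_model M" "is_policy M \<mu>"
  shows "policy_rev M \<mu> = (\<Sum>i\<in>products M. revenue M i * measure_pmf.expectation
     (Pi_pmf (periods M) False (\<lambda>t. bernoulli_pmf (purchase_prob M \<mu> i t)))
     (\<lambda>B. real (min (stock M i) (\<Sum>t\<in>periods M. of_bool (B t)))))"
proof -
  let ?P = "choice_process M \<mu>"
  let ?n = "\<lambda>X i. card {s\<in>periods M. X s = Some i}"
  have fin: "finite (periods M)" by (simp add: periods_def)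
  have "policy_rev M \<mu> = measure_pmf.expectation ?P
      (\<lambda>X. \<Sum>i\<in>products M. revenue M i * real (min (stock M i) (?n X i)))"
    unfolding policy_rev_def
  proof (intro integral_cong_AE)
    show "AE X in ?P. (\<Sum>t\<in>periods M. collected M X t) =
        (\<Sum>i\<in>products M. revenue M i * real (min (stock M i) (?n X i)))"
      unfolding AE_measure_pmf_iff periods_def
      by (intro ballI sum_collected set_choice_process[OF assms])
  qed auto
  also have "\<dots> = (\<Sum>i\<in>products M. revenue M i *
      measure_pmf.expectation ?P (\<lambda>X. real (min (stock M i) (?n X i))))"
    by (subst Bochner_Integration.integral_sum)
       (auto intro!: integrable_measure_pmf_finite finite_set_choice_process assms)
  also have "\<dots> = (\<Sum>i\<in>products M. revenue M i * measure_pmf.expectation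
     (Pi_pmf (periods M) False (\<lambda>t. bernoulli_pmf (purchase_prob M \<mu> i t)))
     (\<lambda>B. real (min (stock M i) (\<Sum>t\<in>periods M. of_bool (B t)))))"
  proof (intro sum.cong refl arg_cong2[where f = "(*)"])
    fix i assume i: "i \<in> products M"
    have "Pi_pmf (periods M) False (\<lambda>t. bernoulli_pmf (purchase_prob M \<mu> i t)) =
        Pi_pmf (periods M) False (\<lambda>t. map_pmf (\<lambda>x. x = Some i) (period_choice M \<mu> t))"
      using map_period_choice[OF assms _ i] by (intro Pi_pmf_cong) auto
    also have "\<dots> = map_pmf (\<lambda>X. (\<lambda>x. x = Some i) \<circ> X) ?P"
      unfolding choice_process_def by (intro Pi_pmf_map fin) simp
    finally show "measure_pmf.expectation ?P (\<lambda>X. real (min (stock M i) (?n X i))) =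
       measure_pmf.expectation
        (Pi_pmf (periods M) False (\<lambda>t. bernoulli_pmf (purchase_prob M \<mu> i t)))
        (\<lambda>B. real (min (stock M i) (\<Sum>t\<in>periods M. of_bool (B t))))"
      using fin by (simp add: sum_of_bool_eq Int_def)
  qed
  finally show ?thesis .
qed

lemma finite_policy_rev_deterministic:
  assumes "valid_model M"
  shows "finite (policy_rev M ` {\<mu>. deterministic_policy M \<mu>})" "{\<mu>. deterministic_policy M \<mu>} \<noteq> {}"
proof -
  let ?F = "PiE (types M \<times> periods M) (\<lambda>_. Pow (products M))"
  let ?g = "\<lambda>\<sigma>. policy_rev M (\<lambda>j t. return_pmf (\<sigma> (j, t)))"
  have fin: "finite ?F"
    by (intro finite_PiE) (auto simp: types_def periods_def products_def)
  have "policy_rev M ` {\<mu>. deterministic_policy M \<mu>} \<subseteq> ?g ` ?F"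
  proof safe
    fix \<mu> assume d: "deterministic_policy M \<mu>"
    define \<sigma> where "\<sigma> = (\<lambda>p\<in>types M \<times> periods M. the_elem (set_pmf (\<mu> (fst p) (snd p))))"
    have eq: "\<mu> j t = return_pmf (\<sigma> (j, t))" if "j \<in> types M" "t \<in> periods M" for j t
      using d that by (force simp: deterministic_policy_def \<sigma>_def)
    have mem: "\<sigma> \<in> ?F"
    proof (rule PiE_I)
      fix p assume "p \<in> types M \<times> periods M"
      then obtain j t where p: "p = (j, t)" "j \<in> types M" "t \<in> periods M" by auto
      have "set_pmf (\<mu> j t) \<subseteq> Pow (products M)"
        using d p by (auto simp: deterministic_policy_def is_policy_def)
      then show "\<sigma> p \<in> Pow (products M)" using eq[OF p(2,3)] p(1) by simp
    qed (auto simp: \<sigma>_def)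
    have "purchase_prob M \<mu> i t = purchase_prob M (\<lambda>j t. return_pmf (\<sigma> (j, t))) i t"
      if "t \<in> periods M" for i t
      unfolding purchase_prob_def using eq that by (intro sum.cong) auto
    moreover have "is_policy M (\<lambda>j t. return_pmf (\<sigma> (j, t)))"
      using mem by (auto simp: is_policy_def PiE_iff)
    ultimately have "policy_rev M \<mu> = ?g \<sigma>"
      using assms d
      by (simp add: policy_rev_eq deterministic_policy_def cong: Pi_pmf_cong)
    then show "policy_rev M \<mu> \<in> ?g ` ?F" using mem by blast
  qed
  then show "finite (policy_rev M ` {\<mu>. deterministic_policy M \<mu>})"
    using fin finite_surj by blast
  have "deterministic_policy M (\<lambda>_ _. return_pmf {})"
    by (auto simp: deterministic_policy_def is_policy_def)
  then show "{\<mu>. deterministic_policy M \<mu>} \<noteq> {}" by blast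
qed

end

theory Submission
  imports Defs
begin

text \<open>
  The revenue is a sum over products of \<open>r\<^sub>i * E (min c\<^sub>i N\<^sub>i)\<close>, with \<open>N\<^sub>i\<close> a sum of independent
  Bernoulli variables. Each expectation is affine in every single success probability, with slope
  the expected increment of \<open>min c\<^sub>i\<close>. Hence if each assortment of \<open>\<mu>\<close> is separately replaced by
  that of an optimal policy \<open>\<nu>\<close>, then the revenue changes, summed over all types and periods, are the
  slopes at \<open>\<mu>\<close> weighted with the difference of the purchase probabilities of \<open>\<nu>\<close> and \<open>\<mu>\<close>. As
  \<open>min c\<^sub>i\<close> is nondecreasing and concave, the part with the probabilities of \<open>\<nu>\<close> is at least
  \<open>rev \<nu> - rev \<mu>\<close> and the part with those of \<open>\<mu>\<close> is at most \<open>rev \<mu>\<close>. Local optimality bounds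
  the total by \<open>4 * \<epsilon> * rev \<mu>\<close>, so \<open>rev \<nu> \<le> (2 + 4 * \<epsilon>) * rev \<mu>\<close>.
\<close>

section \<open>Counts of independent Bernoulli successes\<close>

definition success_count :: "'a set \<Rightarrow> ('a \<Rightarrow> real) \<Rightarrow> nat pmf" where
  "success_count A p =
     map_pmf (\<lambda>B. \<Sum>t\<in>A. of_bool (B t)) (Pi_pmf A False (\<lambda>t. bernoulli_pmf (p t)))"

abbreviation count_mean :: "'a set \<Rightarrow> ('a \<Rightarrow> real) \<Rightarrow> (nat \<Rightarrow> real) \<Rightarrow> real" where
  "count_mean A p \<equiv> measure_pmf.expectation (success_count A p)"

abbreviation increment :: "(nat \<Rightarrow> real) \<Rightarrow> nat \<Rightarrow> real" where
  "increment g \<equiv> \<lambda>n. g (Suc n) - g n"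

lemma success_count_empty [simp]: "success_count {} p = return_pmf 0"
  by (simp add: success_count_def)

lemma success_count_cong:
  assumes "\<And>t. t \<in> A \<Longrightarrow> p t = q t"
  shows "success_count A p = success_count A q"
  using assms unfolding success_count_def by (auto intro!: arg_cong2[where f = map_pmf] Pi_pmf_cong)

lemma success_count_insert:
  assumes "finite A" "x \<notin> A"
  shows "success_count (insert x A) p =
    bind_pmf (bernoulli_pmf (p x)) (\<lambda>b. map_pmf (\<lambda>n. of_bool b + n) (success_count A p))"
proof -
  have "(\<Sum>t\<in>A. of_bool ((B(x := b)) t)) = (\<Sum>t\<in>A. of_bool (B t) :: nat)" for B b
    using assms(2) by (intro sum.cong) auto
  then have "(\<Sum>t\<in>insert x A. of_bool ((B(x := b)) t)) =
      of_bool b + (\<Sum>t\<in>A. of_bool (B t) :: nat)" for B b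
    using assms by (simp del: fun_upd_apply sum_of_bool_eq) (simp del: sum_of_bool_eq)
  then show ?thesis
    using assms unfolding success_count_def
    by (simp add: Pi_pmf_insert pair_pmf_def map_pmf_def bind_assoc_pmf bind_return_pmf
          del: fun_upd_apply sum_of_bool_eq sum.insert)
qed

lemma finite_set_success_count:
  assumes "finite A"
  shows "finite (set_pmf (success_count A p))"
proof (rule finite_subset)
  have "(\<Sum>t\<in>A. of_bool (B t)) \<le> card A" for B
    using sum_mono[of A "\<lambda>t. of_bool (B t) :: nat" "\<lambda>_. 1"] by (simp add: of_bool_def)
  then show "set_pmf (success_count A p) \<subseteq> {..card A}"
    by (auto simp: success_count_def)
qed simp

lemma integrable_success_count:
  "finite A \<Longrightarrow> integrable (measure_pmf (success_count A p)) (g :: nat \<Rightarrow> real)"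
  by (intro integrable_measure_pmf_finite finite_set_success_count)

lemma count_mean_mono:
  assumes "finite A" "\<And>n. g n \<le> h n"
  shows "count_mean A p g \<le> count_mean A p h"
  using assms by (intro integral_mono integrable_success_count)

text \<open>Conditioning on trial \<open>x\<close>, a success shifts the independent remaining count
  by one. The mean is thus affine in \<open>p x\<close>, with a slope that involves only the other
  trials.\<close>

lemma count_mean_insert:
  assumes "finite A" "x \<notin> A" "0 \<le> p x" "p x \<le> 1"
  shows "count_mean (insert x A) p g = count_mean A p g + p x * count_mean A p (increment g)"
proof -
  have "count_mean (insert x A) p g =
      p x * count_mean A p (\<lambda>n. g (Suc n)) + (1 - p x) * count_mean A p g"
    unfolding success_count_insert[OF assms(1,2)]
    by (subst pmf_expectation_bind[where A = UNIV])
       (use assms finite_set_success_count in \<open>auto simp: UNIV_bool\<close>)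
  then show ?thesis
    using assms(1) by (simp add: integrable_success_count algebra_simps)
qed

lemma count_mean_remove:
  assumes "finite A" "x \<in> A" "0 \<le> p x" "p x \<le> 1"
  shows "count_mean A p g = count_mean (A - {x}) p g + p x * count_mean (A - {x}) p (increment g)"
  using count_mean_insert[of "A - {x}" x p g] assms by (simp add: insert_absorb)

lemma count_mean_antimono_set:
  assumes "finite A" "x \<notin> A" "0 \<le> p x" "p x \<le> 1" "antimono g"
  shows "count_mean (insert x A) p g \<le> count_mean A p g"
proof -
  have "count_mean A p (increment g) \<le> count_mean A p (\<lambda>_. 0)"
    using assms by (intro count_mean_mono) (simp_all add: antimonoD)
  then show ?thesis
    using assms by (simp add: count_mean_insert mult_nonneg_nonpos)
qed

text \<open>Insert the trials one by one. The mean grows by exactly the term of the new trial, while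
  the terms of earlier trials can only shrink: the new trial enlarges their counts and increments
  decrease.\<close>

lemma sum_increment_le_count_mean:
  assumes "finite A" "\<And>t. t \<in> A \<Longrightarrow> 0 \<le> p t \<and> p t \<le> 1" "antimono (increment g)"
  shows "(\<Sum>t\<in>A. p t * count_mean (A - {t}) p (increment g)) \<le> count_mean A p g - g 0"
  using assms(1,2)
proof (induction A rule: finite_induct)
  case (insert x A)
  have "(\<Sum>t\<in>A. p t * count_mean (insert x A - {t}) p (increment g)) \<le>
      (\<Sum>t\<in>A. p t * count_mean (A - {t}) p (increment g))"
  proof (intro sum_mono mult_left_mono)
    fix t assume t: "t \<in> A"
    then have "insert x A - {t} = insert x (A - {t})"
      using insert.hyps by auto
    then show "count_mean (insert x A - {t}) p (increment g) \<le>
        count_mean (A - {t}) p (increment g)"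
      using insert.hyps insert.prems assms(3) count_mean_antimono_set[of "A - {t}" x p "increment g"]
      by simp
  qed (use insert.prems in auto)
  then show ?case
    using insert.hyps insert.prems insert.IH by (simp add: count_mean_insert)
qed simp

text \<open>By concavity, each new trial adds \<open>p x\<close> times an expected increment that is
  at most the first increment.\<close>

lemma count_mean_le_linear:
  assumes "finite A" "\<And>t. t \<in> A \<Longrightarrow> 0 \<le> p t \<and> p t \<le> 1" "antimono (increment g)"
  shows "count_mean A p g \<le> g 0 + (\<Sum>t\<in>A. p t) * increment g 0"
  using assms(1,2)
proof (induction A rule: finite_induct)
  case (insert x A)
  have "count_mean A p (increment g) \<le> count_mean A p (\<lambda>_. increment g 0)"
    using insert.hyps antimonoD[OF assms(3), of 0] by (intro count_mean_mono) auto
  then have "p x * count_mean A p (increment g) \<le> p x * increment g 0"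
    using insert.prems by (intro mult_left_mono) auto
  then show ?case
    using insert.hyps insert.prems insert.IH by (simp add: count_mean_insert distrib_right)
qed simp

text \<open>By monotonicity the count with probabilities \<open>q\<close> may be shifted by an independent count with
  probabilities \<open>p\<close>; concavity then bounds the shifted mean by its linearization at the shift.\<close>
lemma count_mean_le_increments:
  assumes "finite A"
    and p: "\<And>t. t \<in> A \<Longrightarrow> 0 \<le> p t \<and> p t \<le> 1" and q: "\<And>t. t \<in> A \<Longrightarrow> 0 \<le> q t \<and> q t \<le> 1"
    and "mono g" and concave: "antimono (increment g)"
  shows "count_mean A q g \<le>
    count_mean A p g + (\<Sum>t\<in>A. q t * count_mean (A - {t}) p (increment g))"
proof -
  have "count_mean A q g \<le> g n + (\<Sum>t\<in>A. q t) * increment g n" for n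
  proof -
    have "count_mean A q g \<le> count_mean A q (\<lambda>k. g (n + k))"
      using assms by (intro count_mean_mono) (auto intro: monoD)
    also have "\<dots> \<le> g n + (\<Sum>t\<in>A. q t) * increment g n"
      using count_mean_le_linear[of A q "\<lambda>k. g (n + k)"] assms(1) q concave
      by (simp add: antimono_def)
    finally show ?thesis .
  qed
  then have "count_mean A p (\<lambda>_. count_mean A q g) \<le>
      count_mean A p (\<lambda>n. g n + (\<Sum>t\<in>A. q t) * increment g n)"
    using assms(1) by (intro count_mean_mono)
  then have "count_mean A q g \<le>
      count_mean A p g + (\<Sum>t\<in>A. q t * count_mean A p (increment g))"
    using assms(1) by (simp add: integrable_success_count sum_distrib_right)
  \<comment> \<open>\<open>increment g\<close> is antitone, so leaving trial \<open>t\<close> out of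
    the count can only raise its mean.\<close>
  also have "(\<Sum>t\<in>A. q t * count_mean A p (increment g)) \<le>
      (\<Sum>t\<in>A. q t * count_mean (A - {t}) p (increment g))"
  proof (intro sum_mono mult_left_mono)
    fix t assume "t \<in> A"
    then show "count_mean A p (increment g) \<le> count_mean (A - {t}) p (increment g)"
      using count_mean_antimono_set[of "A - {t}" t p "increment g"] assms(1) p concave
      by (simp add: insert_absorb)
  qed (use q in auto)
  finally show ?thesis by simp
qed

section \<open>Revenue as a function of the purchase probabilities\<close>

abbreviation sales :: "retail_model \<Rightarrow> nat \<Rightarrow> nat \<Rightarrow> real" where
  "sales M i \<equiv> \<lambda>n. real (min (stock M i) n)"

lemma mono_sales: "mono (sales M i)"
  by (auto intro!: monoI)

text \<open>The increment is 1 below the stock level and 0 from there on.\<close>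

lemma antimono_increment_sales: "antimono (increment (sales M i))"
  by (rule antimonoI) (auto simp: min_def)

lemma policy_rev_count_mean:
  assumes "valid_model M" "is_policy M \<mu>"
  shows "policy_rev M \<mu> = (\<Sum>i\<in>products M. revenue M i *
    count_mean (periods M) (purchase_prob M \<mu> i) (sales M i))"
  using assms by (simp add: policy_rev_eq success_count_def)

lemma policy_rev_nonneg:
  assumes "valid_model M" "is_policy M \<mu>"
  shows "policy_rev M \<mu> \<ge> 0"
  unfolding policy_rev_count_mean[OF assms] using assms(1)
  by (auto simp: valid_model_def intro!: sum_nonneg mult_nonneg_nonneg)

lemma purchase_prob_bounds:
  assumes "valid_model M" "is_policy M \<mu>" "i \<in> products M" "t \<in> periods M"
  shows "0 \<le> purchase_prob M \<mu> i t \<and> purchase_prob M \<mu> i t \<le> 1"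
  using pmf_period_choice[OF assms(1,2,4,3)] by (metis pmf_nonneg pmf_le_1)

section \<open>Effect of replacing a single assortment\<close>

text \<open>The partial derivative of the expected sales of \<open>i\<close> in its purchase
  probability at \<open>t\<close>. Period \<open>t\<close> is left out of the count, so changes at
  \<open>t\<close> do not affect it.\<close>

definition marginal_sales :: "retail_model \<Rightarrow> policy \<Rightarrow> nat \<Rightarrow> nat \<Rightarrow> real" where
  "marginal_sales M \<mu> i t =
     count_mean (periods M - {t}) (purchase_prob M \<mu> i) (increment (sales M i))"

definition type_purchase_prob :: "retail_model \<Rightarrow> policy \<Rightarrow> nat \<Rightarrow> nat \<Rightarrow> nat \<Rightarrow> real" where
  "type_purchase_prob M \<mu> i j t =
     arrival_prob M j t * (\<Sum>S\<in>Pow (products M). pmf (\<mu> j t) S * choice_prob M i j S)"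

lemma purchase_prob_eq_sum_types:
  "purchase_prob M \<mu> i t = (\<Sum>j\<in>types M. type_purchase_prob M \<mu> i j t)"
  by (simp add: purchase_prob_def type_purchase_prob_def)

text \<open>The new assortment is read off a second policy \<open>\<nu>\<close>, so that summing the
  changes over all types yields the difference of the purchase probabilities of \<open>\<nu>\<close>
  and \<open>\<mu>\<close>.\<close>

lemma purchase_prob_replace_assortment:
  assumes "j \<in> types M" "\<nu> j t = return_pmf S"
  shows "purchase_prob M (replace_assortment \<mu> j t S) i s = purchase_prob M \<mu> i s +
    (if s = t then type_purchase_prob M \<nu> i j t - type_purchase_prob M \<mu> i j t else 0)"
proof -
  have "type_purchase_prob M (replace_assortment \<mu> j t S) i k s = type_purchase_prob M \<mu> i k s +
      (if k = j then if s = t then type_purchase_prob M \<nu> i j t - type_purchase_prob M \<mu> i j t else 0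
       else 0)" for k
    using assms(2) by (auto simp: type_purchase_prob_def replace_assortment_def)
  then show ?thesis
    using assms(1) by (simp add: purchase_prob_eq_sum_types sum.distrib types_def)
qed

lemma is_policy_replace_assortment:
  assumes "is_policy M \<mu>" "S \<subseteq> products M"
  shows "is_policy M (replace_assortment \<mu> j t S)"
  using assms by (auto simp: is_policy_def replace_assortment_def)

lemma policy_rev_replace_assortment:
  assumes "valid_model M" "is_policy M \<mu>" "j \<in> types M" "t \<in> periods M" "S \<subseteq> products M"
    and "\<nu> j t = return_pmf S"
  shows "policy_rev M (replace_assortment \<mu> j t S) - policy_rev M \<mu> =
    (\<Sum>i\<in>products M. revenue M i * ((type_purchase_prob M \<nu> i j t - type_purchase_prob M \<mu> i j t) *
       marginal_sales M \<mu> i t))"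
proof -
  let ?\<mu>' = "replace_assortment \<mu> j t S"
  note \<mu>' = is_policy_replace_assortment[OF assms(2,5), of j t]
  have "count_mean (periods M) (purchase_prob M ?\<mu>' i) (sales M i) -
      count_mean (periods M) (purchase_prob M \<mu> i) (sales M i) =
      (type_purchase_prob M \<nu> i j t - type_purchase_prob M \<mu> i j t) * marginal_sales M \<mu> i t"
    if i: "i \<in> products M" for i
  proof -
    have fin: "finite (periods M)" by (simp add: periods_def)
    have prob: "purchase_prob M ?\<mu>' i s = purchase_prob M \<mu> i s +
        (if s = t then type_purchase_prob M \<nu> i j t - type_purchase_prob M \<mu> i j t else 0)" for s
      using assms(3,6) by (rule purchase_prob_replace_assortment)
    \<comment> \<open>The purchase probabilities differ only at \<open>t\<close>, so both expansions
      at \<open>t\<close> have the same intercept and slope.\<close>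
    have other: "success_count (periods M - {t}) (purchase_prob M ?\<mu>' i) =
        success_count (periods M - {t}) (purchase_prob M \<mu> i)"
      by (rule success_count_cong) (simp add: prob)
    show ?thesis
      using purchase_prob_bounds[OF assms(1,2) i assms(4)] purchase_prob_bounds[OF assms(1) \<mu>' i assms(4)]
        count_mean_remove[OF fin assms(4), of "purchase_prob M ?\<mu>' i" "sales M i"]
        count_mean_remove[OF fin assms(4), of "purchase_prob M \<mu> i" "sales M i"]
      by (simp add: other marginal_sales_def prob algebra_simps)
  qed
  then show ?thesis
    unfolding policy_rev_count_mean[OF assms(1,2)] policy_rev_count_mean[OF assms(1) \<mu>']
    by (simp flip: sum_subtractf right_diff_distrib)
qed

section \<open>Comparison with another policy\<close>

text \<open>One copy of \<open>policy_rev M \<mu>\<close> is the base value of the concavity bound,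
  the other pays for the purchase probabilities of \<open>\<mu>\<close> that are given up. This is
  the source of the factor 1/2.\<close>

lemma marginal_sales_lower_bound:
  assumes "valid_model M" "is_policy M \<mu>" "is_policy M \<nu>"
  shows "policy_rev M \<nu> - 2 * policy_rev M \<mu> \<le>
    (\<Sum>i\<in>products M. revenue M i * (\<Sum>t\<in>periods M.
       (purchase_prob M \<nu> i t - purchase_prob M \<mu> i t) * marginal_sales M \<mu> i t))"
proof -
  let ?E = "\<lambda>\<mu> i. count_mean (periods M) (purchase_prob M \<mu> i) (sales M i)"
  have "policy_rev M \<nu> - 2 * policy_rev M \<mu> =
      (\<Sum>i\<in>products M. revenue M i * (?E \<nu> i - 2 * ?E \<mu> i))"
    by (simp add: policy_rev_count_mean assms sum_distrib_left algebra_simps flip: sum_subtractf)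
  also have "\<dots> \<le> (\<Sum>i\<in>products M. revenue M i * (\<Sum>t\<in>periods M.
       (purchase_prob M \<nu> i t - purchase_prob M \<mu> i t) * marginal_sales M \<mu> i t))"
  proof (intro sum_mono mult_left_mono)
    fix i assume i: "i \<in> products M"
    have fin: "finite (periods M)" by (simp add: periods_def)
    note bounds = purchase_prob_bounds[OF assms(1,2) i] purchase_prob_bounds[OF assms(1,3) i]
    have "?E \<nu> i \<le> ?E \<mu> i + (\<Sum>t\<in>periods M. purchase_prob M \<nu> i t * marginal_sales M \<mu> i t)"
      unfolding marginal_sales_def
      by (rule count_mean_le_increments[OF fin bounds mono_sales antimono_increment_sales])
    moreover have "(\<Sum>t\<in>periods M. purchase_prob M \<mu> i t * marginal_sales M \<mu> i t) \<le> ?E \<mu> i"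
      using sum_increment_le_count_mean[OF fin bounds(1) antimono_increment_sales]
      by (simp add: marginal_sales_def)
    ultimately show "?E \<nu> i - 2 * ?E \<mu> i \<le> (\<Sum>t\<in>periods M.
        (purchase_prob M \<nu> i t - purchase_prob M \<mu> i t) * marginal_sales M \<mu> i t)"
      by (simp add: left_diff_distrib sum_subtractf)
    show "0 \<le> revenue M i" using assms(1) i by (simp add: valid_model_def)
  qed
  finally show ?thesis .
qed

text \<open>Every replacement starts from \<open>\<mu>\<close> itself, not from an earlier
  replacement, so all gains carry the same weights \<open>marginal_sales M \<mu>\<close> and add up
  exactly.\<close>

lemma sum_replacement_gains_ge:
  assumes "valid_model M" "is_policy M \<mu>" "is_policy M \<nu>"
    and \<nu>: "\<And>j t. j \<in> types M \<Longrightarrow> t \<in> periods M \<Longrightarrow> \<nu> j t = return_pmf (S j t)"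
  shows "policy_rev M \<nu> - 2 * policy_rev M \<mu> \<le>
    (\<Sum>t\<in>periods M. \<Sum>j\<in>types M. policy_rev M (replace_assortment \<mu> j t (S j t)) - policy_rev M \<mu>)"
proof -
  have S: "S j t \<subseteq> products M" if "j \<in> types M" "t \<in> periods M" for j t
    using assms(3) \<nu>[OF that] that by (force simp: is_policy_def)
  let ?d = "\<lambda>i j t. type_purchase_prob M \<nu> i j t - type_purchase_prob M \<mu> i j t"
  have "(\<Sum>t\<in>periods M. \<Sum>j\<in>types M.
        policy_rev M (replace_assortment \<mu> j t (S j t)) - policy_rev M \<mu>) =
      (\<Sum>t\<in>periods M. \<Sum>j\<in>types M. \<Sum>i\<in>products M.
        revenue M i * (?d i j t * marginal_sales M \<mu> i t))"
    using assms \<nu> S by (intro sum.cong refl policy_rev_replace_assortment) auto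
  also have "\<dots> = (\<Sum>t\<in>periods M. \<Sum>i\<in>products M. \<Sum>j\<in>types M.
        revenue M i * (?d i j t * marginal_sales M \<mu> i t))"
    by (intro sum.cong refl sum.swap)
  also have "\<dots> = (\<Sum>i\<in>products M. \<Sum>t\<in>periods M. \<Sum>j\<in>types M.
        revenue M i * (?d i j t * marginal_sales M \<mu> i t))"
    by (rule sum.swap)
  also have "\<dots> = (\<Sum>i\<in>products M. revenue M i * (\<Sum>t\<in>periods M.
       (purchase_prob M \<nu> i t - purchase_prob M \<mu> i t) * marginal_sales M \<mu> i t))"
    by (simp add: purchase_prob_eq_sum_types sum_distrib_left sum_distrib_right flip: sum_subtractf)
  finally show ?thesis
    using marginal_sales_lower_bound[OF assms(1-3)] by simp
qed

theorem corollary4p2: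
  fixes M :: retail_model and \<mu> :: policy and \<epsilon> :: real
  assumes "valid_model M"
    and "\<epsilon> > 0"
    and "deterministic_policy M \<mu>"
    and "\<forall>j\<in>types M. \<forall>t\<in>periods M. \<forall>S. S \<subseteq> products M \<longrightarrow>
           policy_rev M (replace_assortment \<mu> j t S)
             \<le> (1 + \<epsilon> * (4 / (real (num_types M) * real (horizon M)))) * policy_rev M \<mu>"
  shows "policy_rev M \<mu> \<ge> (1 / 2 - \<epsilon>) * opt_det M"
proof -
  let ?R = "policy_rev M \<mu>" and ?mT = "real (num_types M) * real (horizon M)"
  obtain \<nu> where \<nu>: "deterministic_policy M \<nu>" and opt: "opt_det M = policy_rev M \<nu>"
    using Max_in[OF finite_policy_rev_deterministic(1)[OF assms(1)]]
      finite_policy_rev_deterministic(2)[OF assms(1)]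
    unfolding opt_det_def by auto
  have pol: "is_policy M \<mu>" "is_policy M \<nu>"
    using assms(3) \<nu> by (auto simp: deterministic_policy_def)
  have R: "?R \<ge> 0" and N: "policy_rev M \<nu> \<ge> 0"
    using pol policy_rev_nonneg[OF assms(1)] by auto
  obtain S where S: "\<And>j t. j \<in> types M \<Longrightarrow> t \<in> periods M \<Longrightarrow> \<nu> j t = return_pmf (S j t)"
    using \<nu> unfolding deterministic_policy_def by metis
  have "policy_rev M \<nu> - 2 * ?R \<le> (\<Sum>t\<in>periods M. \<Sum>j\<in>types M.
      policy_rev M (replace_assortment \<mu> j t (S j t)) - ?R)"
    using assms(1) pol S by (rule sum_replacement_gains_ge)
  also have "\<dots> \<le> (\<Sum>t\<in>periods M. \<Sum>j\<in>types M. \<epsilon> * (4 / ?mT) * ?R)"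
  proof (intro sum_mono)
    fix t j assume jt: "t \<in> periods M" "j \<in> types M"
    then have "S j t \<subseteq> products M"
      using pol(2) S[OF jt(2,1)] by (force simp: is_policy_def)
    with assms(4) jt have "policy_rev M (replace_assortment \<mu> j t (S j t)) \<le>
        (1 + \<epsilon> * (4 / ?mT)) * ?R"
      by blast
    then show "policy_rev M (replace_assortment \<mu> j t (S j t)) - ?R \<le> \<epsilon> * (4 / ?mT) * ?R"
      by (simp only: distrib_right)
  qed
  \<comment> \<open>There are \<open>?mT\<close> equal summands. If \<open>?mT\<close> is 0 the sum
    is empty, hence an inequality and not an equality.\<close>
  also have "\<dots> \<le> 4 * \<epsilon> * ?R"
    using assms(2) R by (simp add: types_def periods_def field_simps)
  finally have bound: "policy_rev M \<nu> \<le> (2 + 4 * \<epsilon>) * ?R"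
    by (simp add: algebra_simps)
  \<comment> \<open>For a nonnegative factor \<open>1 / 2 - \<epsilon>\<close>, its product with
    \<open>2 + 4 * \<epsilon>\<close> is \<open>1 - 4 * \<epsilon>\<^sup>2\<close>, at most 1. For a
    negative factor the claimed lower bound is nonpositive.\<close>
  show ?thesis
  proof (cases "\<epsilon> \<le> 1 / 2")
    case True
    then have "(1 / 2 - \<epsilon>) * policy_rev M \<nu> \<le> (1 / 2 - \<epsilon>) * ((2 + 4 * \<epsilon>) * ?R)"
      using bound by (intro mult_left_mono) auto
    also have "\<dots> = ?R - 4 * \<epsilon>\<^sup>2 * ?R"
      by (simp add: algebra_simps power2_eq_square)
    also have "\<dots> \<le> ?R" using R by simp
    finally show ?thesis by (simp add: opt)
  next
    case False
    then have "(1 / 2 - \<epsilon>) * policy_rev M \<nu> \<le> 0"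
      using N by (intro mult_nonpos_nonneg) auto
    then show ?thesis using R by (simp add: opt)
  qed
qed

end
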